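(* Let $k\ge 0$ and $b\ge 2$ be integers. (i) If $a=20k+15$, then $\#S(a,b)=b\cdot\left(v_2(a^2-1)-1\right)+1$. (ii) If $a=20k+25$, then $\#S(a,b)=(b+1)\cdot\left(v_2(a^2-1)-1\right)$.
   Context: $v_2$ denotes the $2$-adic valuation on $\mathbb{Z}$. For an integer $a\ge 1$, the tetration ${}^{b}a$ is defined by ${}^{1}a=a$ and ${}^{b}a=a^{({}^{b-1}a)}$ for $b\ge 2$. For an integer $a\ge 2$ not divisible by $10$ and $b\ge 1$, the number of stable digits $\#S(a,b)$ is the non-negative integer $n$ such that ${}^{b}a\equiv {}^{b+1}a \pmod{10^{n}}$ and ${}^{b}a\not\equiv {}^{b+1}a\pmod{10^{n+1}}$. *)

theory Defs
  imports "HOL-Number_Theory.Number_Theory"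
begin

text \<open>The usual convention that a tower of height zero is one makes a tower of height one
  equal to \<open>a\<close> and gives the recursion at every positive height; see
  \<open>tetration_1\<close> and \<open>tetration_rec\<close>.\<close>

fun tetration :: "nat \<Rightarrow> nat \<Rightarrow> nat" where
  "tetration a 0 = 1"
| "tetration a (Suc b) = a ^ tetration a b"

lemma tetration_1: "tetration a 1 = a"
  by simp

lemma tetration_rec: "b \<ge> 2 \<Longrightarrow> tetration a b = a ^ tetration a (b - 1)"
  by (cases b) auto

text \<open>Only meaningful for \<open>a \<ge> 2\<close> not divisible by 10 and \<open>b \<ge> 1\<close>; the number described
  then exists and is unique, see \<open>stable_digits_ex1\<close>.\<close>

definition stable_digits :: "nat \<Rightarrow> nat \<Rightarrow> nat" where
  "stable_digits a b =
     (THE n. [tetration a b = tetration a (b + 1)] (mod 10 ^ n) \<and>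
             \<not> [tetration a b = tetration a (b + 1)] (mod 10 ^ (n + 1)))"

definition v2 :: "int \<Rightarrow> nat" where
  "v2 x = multiplicity 2 x"

lemma tetration_less_Suc:
  assumes "a \<ge> 2"
  shows "tetration a b < tetration a (Suc b)"
  using assms by (induction b) (auto intro: power_strict_increasing)

lemma stable_digits_ex1:
  assumes "a \<ge> 2"
  shows "\<exists>!n. [tetration a b = tetration a (b + 1)] (mod 10 ^ n) \<and>
              \<not> [tetration a b = tetration a (b + 1)] (mod 10 ^ (n + 1))"
proof -
  define P where "P n \<longleftrightarrow> [tetration a b = tetration a (b + 1)] (mod 10 ^ n)" for n
  have mono: "P m" if "P n" "m \<le> n" for m n
    using that unfolding P_def by (meson cong_dvd_modulus_nat le_imp_power_dvd)
  have lt: "tetration a b < tetration a (b + 1)"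
    using tetration_less_Suc[OF assms] by simp
  have "tetration a (b + 1) < 10 ^ tetration a (b + 1)"
    by (rule power_gt_expt) simp
  with lt have "\<not> P (tetration a (b + 1))"
    unfolding P_def by (simp add: cong_def del: tetration.simps)
  then obtain N where "\<not> P N" by blast
  moreover have "P 0" unfolding P_def by (simp add: cong_def)
  ultimately obtain n where "P n" "\<not> P (Suc n)"
    using nat_induct[of P N] by blast
  moreover have "m = n" if "P m" "\<not> P (Suc m)" for m
    by (metis \<open>P n\<close> \<open>\<not> P (Suc n)\<close> that mono not_less_eq_eq nle_le)
  ultimately show ?thesis
    unfolding P_def[symmetric] by auto
qed

end

theory Submission
  imports Defs
begin

text \<open>The gap \<open>T\<^sub>b\<^sub>+\<^sub>1 - T\<^sub>b\<close> between consecutive towers of \<open>a\<close> equals \<open>T\<^sub>b\<close> times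
  \<open>a ^ d - 1\<close>, where \<open>d\<close> is the previous gap. For odd \<open>a\<close> the first factor does not affect the
  2-adic valuation, and lifting the exponent turns the second into a recursion that adds the same
  amount at every step. As \<open>5 dvd a\<close>, the first factor is divisible by 5 to a power that
  itself grows like a tower, so the prime 2 alone decides the number of stable digits.\<close>

text \<open>Lifting the exponent at 2. If \<open>n = 2 * m\<close>, then \<open>y ^ n - 1\<close>
  splits into \<open>y ^ m - 1\<close> and \<open>y ^ m + 1\<close>, and the latter is 2 modulo 4,
  so each halving of \<open>n\<close> costs exactly one factor 2. If \<open>n\<close> is odd, the
  cofactor of \<open>y - 1\<close> is a sum of an odd number of odd terms.\<close>

lemma multiplicity_2_power_minus_1:
  fixes y :: int
  assumes y: "[y = 1] (mod 4)" "y \<noteq> 1" and n: "n > 0"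
  shows "multiplicity 2 (y ^ n - 1) = multiplicity 2 (y - 1) + multiplicity 2 (int n)"
  using n
proof (induction n rule: less_induct)
  case (less n)
  have mod4: "[y ^ m = 1] (mod 4)" for m
    using cong_pow[OF y(1), of m] by simp
  have "odd y"
    using y(1) by (auto simp: cong_def) presburger
  have "y \<noteq> -1"
    using y(1) by (auto simp: cong_def)
  with y(2) have abs_neq: "\<bar>y\<bar> \<noteq> 1"
    by linarith
  have neq1: "y ^ m \<noteq> 1" if "m > 0" for m
  proof
    assume "y ^ m = 1"
    then have "\<bar>y\<bar> ^ m = 1"
      by (simp flip: power_abs)
    with that abs_neq show False
      using power_eq_imp_eq_base[of "\<bar>y\<bar>" m 1] by simp
  qed
  show ?case
  proof (cases "even n")
    case True
    then obtain m where m: "n = 2 * m" by blast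
    with less.prems have "m > 0" "m < n" by auto
    have "2 dvd z + 1 \<and> \<not> 4 dvd z + 1 \<and> z + 1 \<noteq> 0" if "z mod 4 = 1" for z :: int
      using that by presburger
    from this[of "y ^ m"] have "2 dvd y ^ m + 1" "\<not> 4 dvd y ^ m + 1" "y ^ m + 1 \<noteq> 0"
      using mod4[of m] by (simp_all add: cong_def)
    with neq1[OF \<open>m > 0\<close>] have ne: "y ^ m - 1 \<noteq> 0" "y ^ m + 1 \<noteq> 0"
      by simp_all
    have "multiplicity 2 (y ^ m + 1) = 1"
      using \<open>2 dvd y ^ m + 1\<close> \<open>\<not> 4 dvd y ^ m + 1\<close> by (intro multiplicity_eqI) simp_all
    moreover have "y ^ n - 1 = (y ^ m - 1) * (y ^ m + 1)"
      by (simp only: m mult_2 power_add) (simp add: algebra_simps)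
    moreover have "multiplicity 2 (int n) = Suc (multiplicity 2 (int m))"
      using \<open>m > 0\<close> by (simp add: m multiplicity_times_same)
    ultimately show ?thesis
      using ne less.IH[OF \<open>m < n\<close> \<open>m > 0\<close>] by (simp add: prime_elem_multiplicity_mult_distrib)
  next
    case False
    let ?S = "\<Sum>i<n. y ^ i"
    have "odd ?S"
      using \<open>odd y\<close> False by (simp add: even_sum_iff)
    moreover from this have "?S \<noteq> 0" by auto
    moreover have "y ^ n - 1 = (y - 1) * ?S"
      by (rule power_diff_1_eq)
    moreover have "odd (int n)" using False by simp
    ultimately show ?thesis
      using y(2) by (simp add: prime_elem_multiplicity_mult_distrib not_dvd_imp_multiplicity_0)
  qed
qed

text \<open>For \<open>a \<ge> 2\<close> the towers increase strictly, so the subtraction does not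
  truncate.\<close>

definition tower_gap :: "nat \<Rightarrow> nat \<Rightarrow> nat" where
  "tower_gap a b = tetration a (Suc b) - tetration a b"

lemma tower_gap_pos: "a \<ge> 2 \<Longrightarrow> tower_gap a b > 0"
  unfolding tower_gap_def using tetration_less_Suc[of a b] by linarith

lemma int_tower_gap_0: "a \<ge> 2 \<Longrightarrow> int (tower_gap a 0) = int a - 1"
  by (simp add: tower_gap_def)

text \<open>Both towers are powers of \<open>a\<close> whose exponents differ by the previous gap,
  so the smaller power factors out.\<close>

lemma int_tower_gap_Suc:
  assumes "a \<ge> 2"
  shows "int (tower_gap a (Suc b)) = int a ^ tetration a b * (int a ^ tower_gap a b - 1)"
proof -
  have le: "tetration a b \<le> tetration a (Suc b)" "tetration a (Suc b) \<le> tetration a (Suc (Suc b))"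
    using tetration_less_Suc[OF assms] less_imp_le by blast+
  have "int (tower_gap a (Suc b)) = int a ^ tetration a (Suc b) - int a ^ tetration a b"
    using le by (simp add: tower_gap_def of_nat_diff)
  also have "tetration a (Suc b) = tetration a b + tower_gap a b"
    using le by (simp add: tower_gap_def)
  finally show ?thesis
    by (simp only: power_add right_diff_distrib mult_1_right)
qed

lemma multiplicity_2_tower_gap_Suc:
  assumes "odd a" "a \<ge> 2"
  shows "multiplicity 2 (int (tower_gap a (Suc b))) = multiplicity 2 (int a ^ tower_gap a b - 1)"
proof -
  have "multiplicity 2 (int a ^ tetration a b) = 0"
    using \<open>odd a\<close> by (intro not_dvd_imp_multiplicity_0) simp
  moreover have "int a ^ tower_gap a b - 1 \<noteq> 0"
    using int_tower_gap_Suc[OF assms(2), of b] tower_gap_pos[OF assms(2), of "Suc b"] by auto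
  ultimately show ?thesis
    using assms by (simp add: int_tower_gap_Suc prime_elem_multiplicity_mult_distrib)
qed

text \<open>The initial gap is \<open>a - 1\<close>, and lifting the exponent adds the valuation of
  \<open>a - 1\<close> once per level.\<close>

lemma multiplicity_2_tower_gap_1_mod_4:
  assumes "[a = 1] (mod 4)" "a \<ge> 2"
  shows "multiplicity 2 (int (tower_gap a b)) = (b + 1) * multiplicity 2 (int a - 1)"
proof (induction b)
  case 0
  then show ?case using assms by (simp add: int_tower_gap_0)
next
  case (Suc b)
  have "odd a" using assms(1) by (auto simp: cong_def) presburger
  have "[int a = 1] (mod 4)" using assms(1) cong_int_iff[of a 1 4] by simp
  then show ?case
    using Suc.IH assms tower_gap_pos[OF assms(2), of b] \<open>odd a\<close>
    by (simp add: multiplicity_2_tower_gap_Suc multiplicity_2_power_minus_1)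
qed

text \<open>Lifting applies to the square of \<open>a\<close>, which is 1 modulo 4, because every
  gap is even. The initial gap \<open>a - 1\<close> contributes the summand 1.\<close>

lemma multiplicity_2_tower_gap_3_mod_4:
  assumes "[a = 3] (mod 4)"
  shows "multiplicity 2 (int (tower_gap a b)) = b * multiplicity 2 (int a + 1) + 1"
proof (induction b)
  have "a mod 4 = 3" using assms by (simp add: cong_def)
  then have "a \<ge> 2" by presburger
  have a1: "multiplicity 2 (int a - 1) = 1"
    using \<open>a mod 4 = 3\<close> by (intro multiplicity_eqI; simp; presburger)
  {
    case 0
    then show ?case using \<open>a \<ge> 2\<close> a1 by (simp add: int_tower_gap_0)
  next
    case (Suc b)
    have "odd a" using \<open>a mod 4 = 3\<close> by presburger
    \<comment> \<open>At height 0 the gap is \<open>a - 1\<close>; later gaps are differences of two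
      powers of the odd number \<open>a\<close>.\<close>
    then have "even (tower_gap a b)"
      using \<open>a \<ge> 2\<close> by (cases b) (auto simp: tower_gap_def)
    then obtain m where m: "tower_gap a b = 2 * m" by blast
    with tower_gap_pos[OF \<open>a \<ge> 2\<close>, of b] have "m > 0" by simp
    have "[(int a)\<^sup>2 = (-1)\<^sup>2] (mod 4)"
      using \<open>a mod 4 = 3\<close> by (intro cong_pow) (simp add: cong_iff_dvd_diff, presburger)
    then have sq: "[(int a)\<^sup>2 = 1] (mod 4)" by simp
    have fact: "(int a)\<^sup>2 - 1 = (int a - 1) * (int a + 1)"
      by (simp add: power2_eq_square algebra_simps)
    then have "(int a)\<^sup>2 \<noteq> 1" using \<open>a \<ge> 2\<close> by auto
    have "multiplicity 2 (int (tower_gap a (Suc b))) = multiplicity 2 (((int a)\<^sup>2) ^ m - 1)"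
      using \<open>odd a\<close> \<open>a \<ge> 2\<close> by (simp add: multiplicity_2_tower_gap_Suc m power_mult)
    also have "\<dots> = multiplicity 2 ((int a)\<^sup>2 - 1) + multiplicity 2 (int m)"
      by (rule multiplicity_2_power_minus_1) fact+
    also have "multiplicity 2 ((int a)\<^sup>2 - 1) = 1 + multiplicity 2 (int a + 1)"
      using \<open>a \<ge> 2\<close> a1 by (simp add: fact prime_elem_multiplicity_mult_distrib)
    \<comment> \<open>The single factor 2 of \<open>a - 1\<close> makes up for the one lost in
      halving the gap.\<close>
    also have "Suc (multiplicity 2 (int m)) = multiplicity 2 (int (tower_gap a b))"
      using \<open>m > 0\<close> by (simp add: m multiplicity_times_same)
    then have "1 + multiplicity 2 (int a + 1) + multiplicity 2 (int m)
                 = multiplicity 2 (int a + 1) + multiplicity 2 (int (tower_gap a b))"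
      by simp
    finally show ?case using Suc.IH by simp
  }
qed

text \<open>Ensures enough factors 5: \<open>s\<close> will be the valuation of \<open>a + 1\<close>
  or \<open>a - 1\<close>. One level up, the left side at most doubles, while the tower at least
  doubles.\<close>

lemma linear_le_tetration:
  assumes "2 ^ s \<le> a + 1" "a \<ge> 15"
  shows "(b + 3) * s \<le> tetration a (Suc b)"
proof (induction b)
  case 0
  \<comment> \<open>This fails at \<open>s = 3\<close>; for \<open>s < 4\<close> the bound
    \<open>a \<ge> 15\<close> suffices.\<close>
  have "3 * s + 1 \<le> 2 ^ s" if "s \<ge> 4"
    using that by (induction s rule: dec_induct) auto
  with assms show ?case by (cases "s \<ge> 4") auto
next
  case (Suc b)
  let ?T = "tetration a (Suc b)"
  have "s \<le> (b + 3) * s" by simp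
  with Suc.IH have "(Suc b + 3) * s \<le> 2 * ?T"
    by (simp add: algebra_simps)
  also have "2 * ?T \<le> 2 ^ ?T"
  proof -
    have "2 * t \<le> 2 ^ t" if "t \<ge> 1" for t :: nat
      using that by (induction t rule: dec_induct) auto
    moreover have "?T \<ge> 1" using assms by simp
    ultimately show ?thesis by blast
  qed
  also have "\<dots> \<le> a ^ ?T" using assms by (intro power_mono) auto
  finally show ?case by simp
qed

text \<open>Coprimality of the powers of 2 and 5 yields \<open>10 ^ v\<close>, whereas one more
  factor 10 would bring one factor 2 too many.\<close>

lemma stable_digits_eqI:
  assumes "a \<ge> 2"
    and v: "multiplicity 2 (int (tower_gap a b)) = v"
    and five: "5 ^ v dvd tower_gap a b"
  shows "stable_digits a b = v"
proof -
  let ?P = "\<lambda>n. [tetration a b = tetration a (b + 1)] (mod 10 ^ n)"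
  have P: "?P n \<longleftrightarrow> 10 ^ n dvd int (tower_gap a b)" for n
  proof -
    have "?P n \<longleftrightarrow> [int (tetration a (Suc b)) = int (tetration a b)] (mod 10 ^ n)"
      using cong_int_iff[of "tetration a b" "tetration a (b + 1)" "10 ^ n"]
      by (simp add: cong_sym_eq del: tetration.simps)
    also have "\<dots> \<longleftrightarrow> 10 ^ n dvd int (tower_gap a b)"
      using tetration_less_Suc[OF assms(1), of b]
      by (simp add: cong_iff_dvd_diff tower_gap_def of_nat_diff del: tetration.simps)
    finally show ?thesis .
  qed
  have "2 ^ v dvd int (tower_gap a b)"
    using v multiplicity_dvd by metis
  moreover have "5 ^ v dvd int (tower_gap a b)"
    using five by (metis of_nat_dvd_iff of_nat_numeral of_nat_power)
  moreover have "coprime (2 ^ v :: int) (5 ^ v)"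
    by (simp add: coprime_power_left_iff coprime_power_right_iff)
  ultimately have "2 ^ v * 5 ^ v dvd int (tower_gap a b)"
    by (intro divides_mult)
  then have "10 ^ v dvd int (tower_gap a b)"
    by (simp flip: power_mult_distrib)
  then have "?P v"
    by (simp only: P)
  moreover have "\<not> ?P (v + 1)"
  proof
    assume "?P (v + 1)"
    then have "10 ^ (v + 1) dvd int (tower_gap a b)" by (simp only: P)
    moreover have "(2 :: int) ^ (v + 1) dvd 10 ^ (v + 1)"
      by (intro dvd_power_same) simp
    ultimately have "2 ^ (v + 1) dvd int (tower_gap a b)"
      using dvd_trans by blast
    then have "v + 1 \<le> multiplicity 2 (int (tower_gap a b))"
      using tower_gap_pos[OF assms(1), of b] by (intro multiplicity_geI) auto
    then show False using v by simp
  qed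
  ultimately show ?thesis
    unfolding stable_digits_def using stable_digits_ex1[OF assms(1), of b]
    by (intro the1_equality) auto
qed

text \<open>The factors 5 come from the power of \<open>a\<close> split off in
  \<open>int_tower_gap_Suc\<close>.\<close>

lemma five_power_dvd_tower_gap:
  assumes "5 dvd a" "a \<ge> 2" "v \<le> tetration a b"
  shows "5 ^ v dvd tower_gap a (Suc b)"
proof -
  have "5 ^ v dvd a ^ tetration a b"
    using assms by (meson dvd_power_same dvd_trans le_imp_power_dvd)
  moreover have "int (a ^ tetration a b) dvd int (tower_gap a (Suc b))"
    using assms(2) by (simp add: int_tower_gap_Suc)
  ultimately show ?thesis
    using dvd_trans of_nat_dvd_iff by blast
qed

theorem mainTheorem8:
  fixes k b a :: nat
  assumes "b \<ge> 2"
  shows "(a = 20 * k + 15 \<longrightarrow>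
            int (stable_digits a b) = int b * (int (v2 ((int a)\<^sup>2 - 1)) - 1) + 1) \<and>
         (a = 20 * k + 25 \<longrightarrow>
            int (stable_digits a b) = (int b + 1) * (int (v2 ((int a)\<^sup>2 - 1)) - 1))"
proof (intro conjI impI)
  have fact: "(int a)\<^sup>2 - 1 = (int a - 1) * (int a + 1)"
    by (simp add: power2_eq_square algebra_simps)
  \<comment> \<open>The gap at height \<open>b\<close> contains \<open>a\<close> to the power
    \<open>tetration a (Suc c)\<close>, which is at least
    \<open>(c + 3) * s = (b + 1) * s\<close>.\<close>
  obtain c where b: "b = Suc (Suc c)"
    using assms by (metis Suc_le_D numeral_2_eq_2 Suc_le_mono)
  {
    assume a: "a = 20 * k + 15"
    define s where "s = multiplicity 2 (int a + 1)"
    have "multiplicity 2 (int a - 1) = 1"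
      by (intro multiplicity_eqI; simp add: a; presburger)
    moreover have "int a - 1 \<noteq> 0" using a by simp
    ultimately have v2: "v2 ((int a)\<^sup>2 - 1) = s + 1"
      by (simp add: v2_def fact s_def prime_elem_multiplicity_mult_distrib)
    have "2 ^ s dvd int a + 1"
      by (simp add: s_def multiplicity_dvd)
    then have "2 ^ s \<le> int a + 1"
      by (intro zdvd_imp_le) auto
    then have "int (2 ^ s) \<le> int (a + 1)" by simp
    then have "2 ^ s \<le> a + 1" by (simp only: of_nat_le_iff)
    have "2 dvd int a + 1" using a by simp
    then have "s \<ge> 1"
      unfolding s_def by (intro multiplicity_geI) auto
    \<comment> \<open>Since \<open>s \<ge> 1\<close>, the extra summand 1 fits into one more
      \<open>s\<close>.\<close>
    then have "b * s + 1 \<le> (c + 3) * s"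
      by (simp add: b algebra_simps)
    also have "\<dots> \<le> tetration a (Suc c)"
      using \<open>2 ^ s \<le> a + 1\<close> a by (intro linear_le_tetration) auto
    finally have "5 ^ (b * s + 1) dvd tower_gap a b"
      unfolding b using a by (intro five_power_dvd_tower_gap) auto
    moreover have "multiplicity 2 (int (tower_gap a b)) = b * s + 1"
      unfolding s_def by (rule multiplicity_2_tower_gap_3_mod_4) (simp add: a cong_def, presburger)
    ultimately have "stable_digits a b = b * s + 1"
      using a by (intro stable_digits_eqI) auto
    then show "int (stable_digits a b) = int b * (int (v2 ((int a)\<^sup>2 - 1)) - 1) + 1"
      by (simp add: v2)
  }
  {
    assume a: "a = 20 * k + 25"
    define s where "s = multiplicity 2 (int a - 1)"
    \<comment> \<open>Now \<open>a + 1 = 20 * k + 26\<close> is 2 modulo 4, so \<open>a - 1\<close>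
      and \<open>a + 1\<close> swap roles.\<close>
    have "multiplicity 2 (int a + 1) = 1"
      by (intro multiplicity_eqI; simp add: a; presburger)
    moreover have "int a - 1 \<noteq> 0" using a by simp
    ultimately have v2: "v2 ((int a)\<^sup>2 - 1) = s + 1"
      by (simp add: v2_def fact s_def prime_elem_multiplicity_mult_distrib)
    have "2 ^ s dvd int a - 1"
      by (simp add: s_def multiplicity_dvd)
    then have "2 ^ s \<le> int a - 1"
      using a by (intro zdvd_imp_le) auto
    then have "2 ^ s \<le> int a + 1" by linarith
    then have "int (2 ^ s) \<le> int (a + 1)" by simp
    then have "2 ^ s \<le> a + 1" by (simp only: of_nat_le_iff)
    have "(b + 1) * s = (c + 3) * s"
      by (simp add: b algebra_simps)
    also have "\<dots> \<le> tetration a (Suc c)"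
      using \<open>2 ^ s \<le> a + 1\<close> a by (intro linear_le_tetration) auto
    finally have "5 ^ ((b + 1) * s) dvd tower_gap a b"
      unfolding b using a by (intro five_power_dvd_tower_gap) auto
    moreover have "multiplicity 2 (int (tower_gap a b)) = (b + 1) * s"
      unfolding s_def using a
      by (intro multiplicity_2_tower_gap_1_mod_4) (simp_all add: cong_def, presburger)
    ultimately have "stable_digits a b = (b + 1) * s"
      using a by (intro stable_digits_eqI) auto
    then show "int (stable_digits a b) = (int b + 1) * (int (v2 ((int a)\<^sup>2 - 1)) - 1)"
      by (simp add: v2 algebra_simps)
  }
qed

end
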